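(* Let $\Sigma$ be a (possibly infinite) unranked signature, $\mathcal{X}$ an infinite set of variables disjoint from $\Sigma$, and $>$ a well-founded partial order on $\Sigma$. Let $\rightsquigarrow$ be the rewrite relation induced by the term rewrite system $\mathit{Star}$ on the trees $\mathbb{T}(\Sigma\cup\Sigma^\star,\mathcal{X})$. Then for no (star-free) tree $t\in\mathbb{T}(\Sigma,\mathcal{X})$ do we have $t\rightsquigarrow^+t$.
   Context: Terms: for an unranked signature $\Gamma$ (a set of symbols without fixed arity) and a set $\mathcal{X}$ of variables disjoint from $\Gamma$, the set of terms $\mathcal{T}(\Gamma,\mathcal{X})$ is the smallest set containing $\mathcal{X}$ and containing $f(t_1,\ldots,t_n)$ for all $f\in\Gamma$, $n\ge 0$ and terms $t_1,\ldots,t_n$. A term rewrite system is a set of rules $\ell\to r$; it induces on terms the rewrite relation $C[\sigma(\ell)]\to C[\sigma(r)]$ for all one-hole contexts $C$, rules $\ell\to r$ and substitutions $\sigma$. Trees: $\simeq$ is the equivalence relation on terms generated by swapping two adjacent arguments of a symbol anywhere inside a term, i.e. generated by the rewrite rules $f(\vec u,x,y,\vec w)\to f(\vec u,y,x,\vec w)$ for all symbols $f$. The set of (unordered) trees is $\mathbb{T}(\Gamma,\mathcal{X})=\mathcal{T}(\Gamma,\mathcal{X})/_{\simeq}$. A rewrite relation $\to$ on terms is extended to trees by: $[s]\to[t]$ whenever $s\to t$, for terms $s,t$ with classes $[s],[t]$. Starred signature: $\Sigma^\star=\{f^\star\mid f\in\Sigma\}$, a set of fresh symbols (disjoint from $\Sigma$).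 The system $\mathit{Star}$ over $\Sigma\cup\Sigma^\star$ consists of the following rules, for all $f,g\in\Sigma$, where $\vec x,\vec y,\vec z$ are finite (possibly empty) vectors of distinct variables: (put) $f(\vec x)\rightsquigarrow f^\star(\vec x)$; (select) $f^\star(\vec x,y,\vec z)\rightsquigarrow y$; (copy) $f^\star(\vec x)\rightsquigarrow g(f^\star(\vec x),\ldots,f^\star(\vec x))$ with $0$ or more copies of $f^\star(\vec x)$, if $f>g$; (down) $f^\star(\vec x,g(\vec y),\vec z)\rightsquigarrow f(\vec x,g^\star(\vec y),\ldots,g^\star(\vec y),\vec z)$ with $0$ or more copies of $g^\star(\vec y)$. *)

theory Defs
  imports Main
begin

datatype ('f, 'v) uterm = Var 'v | Fun 'f "('f, 'v) uterm list"

inductive_set terms :: "'f set \<Rightarrow> 'v set \<Rightarrow> ('f, 'v) uterm set"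
  for \<Gamma> :: "'f set" and X :: "'v set" where
  "x \<in> X \<Longrightarrow> Var x \<in> terms \<Gamma> X"
| "f \<in> \<Gamma> \<Longrightarrow> (\<forall>t \<in> set ts. t \<in> terms \<Gamma> X) \<Longrightarrow> Fun f ts \<in> terms \<Gamma> X"

fun subst :: "('v \<Rightarrow> ('f, 'v) uterm) \<Rightarrow> ('f, 'v) uterm \<Rightarrow> ('f, 'v) uterm" where
  "subst \<sigma> (Var x) = \<sigma> x"
| "subst \<sigma> (Fun f ts) = Fun f (map (subst \<sigma>) ts)"

datatype ('f, 'v) ctxt =
  Hole
| More 'f "('f, 'v) uterm list" "('f, 'v) ctxt" "('f, 'v) uterm list"

inductive_set ctxts :: "'f set \<Rightarrow> 'v set \<Rightarrow> ('f, 'v) ctxt set"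
  for \<Gamma> :: "'f set" and X :: "'v set" where
  "Hole \<in> ctxts \<Gamma> X"
| "f \<in> \<Gamma> \<Longrightarrow> set ss \<subseteq> terms \<Gamma> X \<Longrightarrow> C \<in> ctxts \<Gamma> X \<Longrightarrow> set ts \<subseteq> terms \<Gamma> X
    \<Longrightarrow> More f ss C ts \<in> ctxts \<Gamma> X"

fun fill :: "('f, 'v) ctxt \<Rightarrow> ('f, 'v) uterm \<Rightarrow> ('f, 'v) uterm" where
  "fill Hole s = s"
| "fill (More f ss C ts) s = Fun f (ss @ fill C s # ts)"

text \<open>Only the values of \<open>\<sigma>\<close> on \<open>X\<close> are constrained, as it stands for a substitution
  from \<open>X\<close> to \<open>terms \<Gamma> X\<close>.\<close>

definition rewrite ::
    "'f set \<Rightarrow> 'v set \<Rightarrow> ('f, 'v) uterm rel \<Rightarrow> ('f, 'v) uterm rel" where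
  "rewrite \<Gamma> X R = {(fill C (subst \<sigma> l), fill C (subst \<sigma> r)) | C \<sigma> l r.
     C \<in> ctxts \<Gamma> X \<and> \<sigma> ` X \<subseteq> terms \<Gamma> X \<and> (l, r) \<in> R}"

definition swap_rules :: "'f set \<Rightarrow> 'v set \<Rightarrow> ('f, 'v) uterm rel" where
  "swap_rules \<Gamma> X =
     {(Fun f (map Var (us @ [x, y] @ ws)), Fun f (map Var (us @ [y, x] @ ws))) | f us x y ws.
        f \<in> \<Gamma> \<and> set (us @ [x, y] @ ws) \<subseteq> X \<and> distinct (us @ [x, y] @ ws)}"

definition tree_eq :: "'f set \<Rightarrow> 'v set \<Rightarrow> ('f, 'v) uterm rel" where
  "tree_eq \<Gamma> X =
     Restr ((rewrite \<Gamma> X (swap_rules \<Gamma> X) \<union> (rewrite \<Gamma> X (swap_rules \<Gamma> X))\<inverse>)\<^sup>*) (terms \<Gamma> X)"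

definition trees :: "'f set \<Rightarrow> 'v set \<Rightarrow> ('f, 'v) uterm set set" where
  "trees \<Gamma> X = terms \<Gamma> X // tree_eq \<Gamma> X"

definition tree_rewrite ::
    "'f set \<Rightarrow> 'v set \<Rightarrow> ('f, 'v) uterm rel \<Rightarrow> ('f, 'v) uterm set rel" where
  "tree_rewrite \<Gamma> X R =
     {(tree_eq \<Gamma> X `` {s}, tree_eq \<Gamma> X `` {t}) | s t. (s, t) \<in> rewrite \<Gamma> X R}"

datatype 'f starred = Plain 'f | Starred 'f

definition star_sig :: "'f set \<Rightarrow> 'f starred set" where
  "star_sig \<Sigma> = Plain ` \<Sigma> \<union> Starred ` \<Sigma>"

inductive_set star_rules ::
    "'f set \<Rightarrow> 'v set \<Rightarrow> ('f \<Rightarrow> 'f \<Rightarrow> bool) \<Rightarrow> ('f starred, 'v) uterm rel"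
  for \<Sigma> :: "'f set" and X :: "'v set" and gt :: "'f \<Rightarrow> 'f \<Rightarrow> bool" where
  put: "f \<in> \<Sigma> \<Longrightarrow> set xs \<subseteq> X \<Longrightarrow> distinct xs \<Longrightarrow>
    (Fun (Plain f) (map Var xs), Fun (Starred f) (map Var xs)) \<in> star_rules \<Sigma> X gt"
| select: "f \<in> \<Sigma> \<Longrightarrow> set (xs @ [y] @ zs) \<subseteq> X \<Longrightarrow> distinct (xs @ [y] @ zs) \<Longrightarrow>
    (Fun (Starred f) (map Var (xs @ [y] @ zs)), Var y) \<in> star_rules \<Sigma> X gt"
| copy: "f \<in> \<Sigma> \<Longrightarrow> g \<in> \<Sigma> \<Longrightarrow> gt f g \<Longrightarrow> set xs \<subseteq> X \<Longrightarrow> distinct xs \<Longrightarrow>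
    (Fun (Starred f) (map Var xs),
     Fun (Plain g) (replicate n (Fun (Starred f) (map Var xs)))) \<in> star_rules \<Sigma> X gt"
| down: "f \<in> \<Sigma> \<Longrightarrow> g \<in> \<Sigma> \<Longrightarrow> set (xs @ ys @ zs) \<subseteq> X \<Longrightarrow> distinct (xs @ ys @ zs) \<Longrightarrow>
    (Fun (Starred f) (map Var xs @ [Fun (Plain g) (map Var ys)] @ map Var zs),
     Fun (Plain f) (map Var xs @ replicate n (Fun (Starred g) (map Var ys)) @ map Var zs))
    \<in> star_rules \<Sigma> X gt"

definition star_step ::
    "'f set \<Rightarrow> 'v set \<Rightarrow> ('f \<Rightarrow> 'f \<Rightarrow> bool) \<Rightarrow> ('f starred, 'v) uterm set rel" where
  "star_step \<Sigma> X gt = tree_rewrite (star_sig \<Sigma>) X (star_rules \<Sigma> X gt)"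

lemma equiv_tree_eq: "equiv (terms \<Gamma> X) (tree_eq \<Gamma> X)"
proof (rule equivI)
  let ?R = "(rewrite \<Gamma> X (swap_rules \<Gamma> X) \<union> (rewrite \<Gamma> X (swap_rules \<Gamma> X))\<inverse>)\<^sup>*"
  show "tree_eq \<Gamma> X \<subseteq> terms \<Gamma> X \<times> terms \<Gamma> X"
    by (auto simp: tree_eq_def)
  show "refl_on (terms \<Gamma> X) (tree_eq \<Gamma> X)"
    by (auto simp: tree_eq_def refl_on_def)
  have "sym ?R"
    by (intro sym_rtrancl sym_Un_converse)
  then show "sym (tree_eq \<Gamma> X)"
    unfolding tree_eq_def by (auto simp: sym_def)
  have "trans ?R"
    by (rule trans_rtrancl)
  then show "trans (tree_eq \<Gamma> X)"
    unfolding tree_eq_def by (rule trans_Restr)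
qed

lemma Var_in_terms: "Var x \<in> terms \<Gamma> X \<longleftrightarrow> x \<in> X"
  by (auto intro: terms.intros elim: terms.cases)

lemma Fun_in_terms: "Fun f ts \<in> terms \<Gamma> X \<longleftrightarrow> f \<in> \<Gamma> \<and> set ts \<subseteq> terms \<Gamma> X"
  by (subst terms.simps) auto

lemma More_in_ctxts:
  "More f ss C ts \<in> ctxts \<Gamma> X \<longleftrightarrow>
    f \<in> \<Gamma> \<and> set ss \<subseteq> terms \<Gamma> X \<and> C \<in> ctxts \<Gamma> X \<and> set ts \<subseteq> terms \<Gamma> X"
  by (subst ctxts.simps) auto

lemma terms_mono:
  assumes "\<Gamma> \<subseteq> \<Delta>" shows "terms \<Gamma> X \<subseteq> terms \<Delta> X"
proof
  fix t assume "t \<in> terms \<Gamma> X"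
  then show "t \<in> terms \<Delta> X"
    by (induction t) (use assms in \<open>auto simp: Var_in_terms Fun_in_terms\<close>)
qed

lemma ctxts_mono:
  assumes "\<Gamma> \<subseteq> \<Delta>" shows "ctxts \<Gamma> X \<subseteq> ctxts \<Delta> X"
proof
  fix C assume "C \<in> ctxts \<Gamma> X"
  then show "C \<in> ctxts \<Delta> X"
  proof (induction C)
    case 1
    show ?case by (rule ctxts.intros)
  next
    case (2 f ss C ts)
    then show ?case using assms terms_mono[OF assms, of X]
      by (simp add: More_in_ctxts subset_iff)
  qed
qed

lemma fill_in_terms: "fill C s \<in> terms \<Gamma> X \<longleftrightarrow> C \<in> ctxts \<Gamma> X \<and> s \<in> terms \<Gamma> X"
  by (induction C) (auto simp: Fun_in_terms More_in_ctxts ctxts.intros)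

lemma rewrite_mono:
  assumes "\<Gamma> \<subseteq> \<Delta>" shows "rewrite \<Gamma> X (swap_rules \<Gamma> X) \<subseteq> rewrite \<Delta> X (swap_rules \<Delta> X)"
proof -
  have "swap_rules \<Gamma> X \<subseteq> swap_rules \<Delta> X"
    unfolding swap_rules_def using assms by blast
  then show ?thesis
    unfolding rewrite_def using terms_mono[OF assms, of X] ctxts_mono[OF assms, of X]
    by (fast intro: subset_trans)
qed

lemma swap_step_restrict:
  assumes "(s, t) \<in> rewrite \<Delta> X (swap_rules \<Delta> X)"
    and "s \<in> terms \<Gamma> X \<or> t \<in> terms \<Gamma> X"
  shows "(s, t) \<in> rewrite \<Gamma> X (swap_rules \<Gamma> X) \<and> s \<in> terms \<Gamma> X \<and> t \<in> terms \<Gamma> X"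
proof -
  obtain C \<sigma> l r where *: "s = fill C (subst \<sigma> l)" "t = fill C (subst \<sigma> r)"
    "(l, r) \<in> swap_rules \<Delta> X"
    using assms(1) unfolding rewrite_def by blast
  obtain f us x y ws where lr: "l = Fun f (map Var (us @ [x, y] @ ws))"
      "r = Fun f (map Var (us @ [y, x] @ ws))"
    and V: "set (us @ [x, y] @ ws) \<subseteq> X" "distinct (us @ [x, y] @ ws)"
    using *(3) unfolding swap_rules_def by blast
  let ?V = "set (us @ [x, y] @ ws)"
  have C: "C \<in> ctxts \<Gamma> X" and f: "f \<in> \<Gamma>" and \<sigma>: "\<sigma> ` ?V \<subseteq> terms \<Gamma> X"
    using assms(2) unfolding *(1,2) lr by (auto simp: fill_in_terms Fun_in_terms)
  have in_terms: "s \<in> terms \<Gamma> X" "t \<in> terms \<Gamma> X"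
    using C f \<sigma> unfolding *(1,2) lr by (auto simp: fill_in_terms Fun_in_terms)
  define \<tau> where "\<tau> z = (if z \<in> ?V then \<sigma> z else Var z)" for z
  have "\<tau> ` X \<subseteq> terms \<Gamma> X"
    using \<sigma> by (auto simp: \<tau>_def Var_in_terms)
  moreover have "subst \<sigma> l = subst \<tau> l" "subst \<sigma> r = subst \<tau> r"
    unfolding lr by (auto simp: \<tau>_def)
  moreover have "(l, r) \<in> swap_rules \<Gamma> X"
    unfolding swap_rules_def lr using f V by blast
  ultimately have "(s, t) \<in> rewrite \<Gamma> X (swap_rules \<Gamma> X)"
    unfolding rewrite_def *(1,2) using C by auto
  with in_terms show ?thesis by blast
qed

lemma tree_eq_class_mono:
  assumes "\<Gamma> \<subseteq> \<Delta>" "s \<in> terms \<Gamma> X"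
  shows "tree_eq \<Delta> X `` {s} = tree_eq \<Gamma> X `` {s}"
proof -
  let ?R = "\<lambda>\<Gamma>. rewrite \<Gamma> X (swap_rules \<Gamma> X) \<union> (rewrite \<Gamma> X (swap_rules \<Gamma> X))\<inverse>"
  have "?R \<Gamma> \<subseteq> ?R \<Delta>"
    using rewrite_mono[OF assms(1), of X] by blast
  from rtrancl_mono[OF this] have up: "(s, t) \<in> (?R \<Delta>)\<^sup>*" if "(s, t) \<in> (?R \<Gamma>)\<^sup>*" for t
    using that by blast
  have down: "(s, t) \<in> (?R \<Gamma>)\<^sup>* \<and> t \<in> terms \<Gamma> X" if "(s, t) \<in> (?R \<Delta>)\<^sup>*" for t
    using that
  proof (induction rule: rtrancl_induct)
    case base
    show ?case using assms(2) by simp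
  next
    case (step u v)
    then have "(u, v) \<in> ?R \<Gamma> \<and> v \<in> terms \<Gamma> X"
      using swap_step_restrict[of u v \<Delta> X \<Gamma>] swap_step_restrict[of v u \<Delta> X \<Gamma>] by blast
    with step.IH show ?case by (meson rtrancl.rtrancl_into_rtrancl)
  qed
  show ?thesis
    unfolding tree_eq_def using up down assms(2) terms_mono[OF assms(1), of X] by blast
qed

text \<open>Enlarging the signature adds no terms to existing classes, so trees over \<open>\<Sigma>\<close>
  are literally trees over \<open>\<Sigma> \<union> \<Sigma>\<^sup>\<star>\<close>.\<close>

lemma trees_mono:
  assumes "\<Gamma> \<subseteq> \<Delta>" shows "trees \<Gamma> X \<subseteq> trees \<Delta> X"
proof
  fix T assume "T \<in> trees \<Gamma> X"
  then obtain s where s: "s \<in> terms \<Gamma> X" "T = tree_eq \<Gamma> X `` {s}"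
    unfolding trees_def by (auto elim: quotientE)
  then show "T \<in> trees \<Delta> X"
    unfolding trees_def using tree_eq_class_mono[OF assms s(1)] terms_mono[OF assms, of X]
    by (metis quotientI subsetD)
qed

corollary star_free_trees: "trees (Plain ` \<Sigma>) X \<subseteq> trees (star_sig \<Sigma>) X"
  by (rule trees_mono) (simp add: star_sig_def)

end

theory Submission
  imports Defs "HOL-Library.Multiset" "HOL-Library.Extended_Nat"
begin

text \<open>Decorate a finite reduction as follows: when \<open>k\<close> steps remain, every star carries the
  label \<open>k\<close>, while an unstarred symbol always carries the label \<open>\<infinity>\<close>. Every decorated step
  decreases a recursive path order on finite multiset trees that compares, lexicographically,
  the head symbols by the precedence, the multisets of arguments by the multiset extension, and
  the labels. A star-free tree has only one decoration, so a cycle through it would contradict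
  irreflexivity of the path order.\<close>

section \<open>A path order on labelled multiset trees\<close>

datatype 'a mtree = Node 'a enat "'a mtree multiset"

primrec msize :: "'a mtree \<Rightarrow> nat" where
  "msize (Node f n M) = Suc (sum_mset (image_mset msize M))"

lemma msize_arg: "s \<in># M \<Longrightarrow> msize s < msize (Node f n M)"
  by (auto dest!: multi_member_split)

text \<open>Labels count only after heads and argument multisets: \<open>mult\<close> lets the label
  rise while the arguments fall, which is what (down) requires.\<close>

inductive path_less :: "('a \<Rightarrow> 'a \<Rightarrow> bool) \<Rightarrow> 'a mtree \<Rightarrow> 'a mtree \<Rightarrow> bool"
  for p :: "'a \<Rightarrow> 'a \<Rightarrow> bool" where
  arg: "s \<in># M \<Longrightarrow> t = s \<or> path_less p t s \<Longrightarrow> path_less p t (Node f n M)"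
| prec: "p g f \<Longrightarrow> (\<And>t. t \<in># N \<Longrightarrow> path_less p t (Node f n M)) \<Longrightarrow>
    path_less p (Node g m N) (Node f n M)"
| mult: "multp (path_less p) N M \<Longrightarrow> (\<And>t. t \<in># N \<Longrightarrow> path_less p t (Node f n M)) \<Longrightarrow>
    path_less p (Node f m N) (Node f n M)"
| label: "m < n \<Longrightarrow> path_less p (Node f m M) (Node f n M)"

text \<open>The three node-against-node rules share one condition on arguments; for
  \<open>label\<close> it follows from \<open>arg\<close>, as both argument multisets are
  equal.\<close>

lemma path_less_Node_right:
  "path_less p t (Node f n M) \<longleftrightarrow>
    (\<exists>s. s \<in># M \<and> (path_less p)\<^sup>=\<^sup>= t s) \<or>
    (\<exists>g m N. t = Node g m N \<and> (\<forall>u. u \<in># N \<longrightarrow> path_less p u (Node f n M)) \<and>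
      (p g f \<or> g = f \<and> (multp (path_less p) N M \<or> N = M \<and> m < n)))"
  (is "?L \<longleftrightarrow> ?R")
proof
  assume ?L then show ?R
    by (cases rule: path_less.cases) (auto intro: path_less.arg)
next
  assume ?R then show ?L
    by (elim disjE exE conjE) (auto intro: path_less.arg path_less.prec path_less.mult path_less.label)
qed

text \<open>\<open>multp\<close> is a transitive closure, so nothing is asked of \<open>r\<close>;
  hence it can serve inside the proof that \<open>path_less\<close> is transitive.\<close>

lemma multp_trans: "multp r A B \<Longrightarrow> multp r B C \<Longrightarrow> multp r A C"
  unfolding multp_def mult_def by (rule trancl_trans)

text \<open>Each appeal to the induction hypothesis replaces one of the three trees by one of its
  arguments and keeps the other two, so the total size falls.\<close>

lemma path_less_trans:
  assumes p: "transp p"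
  shows "path_less p s t \<Longrightarrow> path_less p t u \<Longrightarrow> path_less p s u"
proof (induction "msize s + msize t + msize u" arbitrary: s t u rule: less_induct)
  case less
  obtain f n M where u: "u = Node f n M" by (cases u)
  consider v where "v \<in># M" "(path_less p)\<^sup>=\<^sup>= t v"
    | g m N where "t = Node g m N" "\<forall>v. v \<in># N \<longrightarrow> path_less p v u"
      "p g f \<or> g = f \<and> (multp (path_less p) N M \<or> N = M \<and> m < n)"
    using path_less_Node_right[THEN iffD1, OF less.prems(2)[unfolded u]] unfolding u by blast
  then show ?case
  proof cases
    case 1
    then have "path_less p s v"
      using less.prems(1) less.hyps[of s t v] msize_arg[of v M f n] by (auto simp: u)
    then show ?thesis using 1(1) unfolding u by (blast intro: path_less.arg)
  next
    case 2
    note tu = 2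
    consider v where "v \<in># N" "(path_less p)\<^sup>=\<^sup>= s v"
      | h l K where "s = Node h l K" "\<forall>v. v \<in># K \<longrightarrow> path_less p v t"
        "p h g \<or> h = g \<and> (multp (path_less p) K N \<or> K = N \<and> l < m)"
      using path_less_Node_right[THEN iffD1, OF less.prems(1)[unfolded tu(1)]]
      unfolding tu(1) by blast
    then show ?thesis
    proof cases
      case 1
      then show ?thesis
        using tu(2) less.hyps[of s v u] msize_arg[of v N g m] by (auto simp: tu(1))
    next
      case 2
      have args: "path_less p v u" if "v \<in># K" for v
        using that 2(2) less.hyps[of v t u] msize_arg[of v K h l] less.prems(2)
        by (auto simp: 2(1))
      have "p h f \<or> h = f \<and> (multp (path_less p) K M \<or> K = M \<and> l < n)"
        using 2(3) tu(3) transpD[OF p, of h g f] multp_trans[of "path_less p" K N M]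
        by (elim disjE conjE) auto
      then show ?thesis
        using args unfolding u 2(1) by (subst path_less_Node_right) blast
    qed
  qed
qed

lemma transp_path_less: "transp p \<Longrightarrow> transp (path_less p)"
  by (blast intro: transpI path_less_trans)

lemma not_multp_self:
  assumes "transp r" "\<And>x. x \<in># M \<Longrightarrow> \<not> r x x"
  shows "\<not> multp r M M"
proof
  \<comment> \<open>Irreflexivity is known only on the elements of \<open>M\<close>, while
    \<open>irreflp_multp\<close> is applied to a globally irreflexive relation; so \<open>r\<close>
    is cut down to \<open>M\<close>.\<close>
  let ?r = "\<lambda>x y. r x y \<and> x \<in># M \<and> y \<in># M"
  assume "multp r M M"
  then have "multp ?r M M"
    by (rule multp_mono_strong) (use assms(1) in auto)
  moreover have "transp ?r" "irreflp ?r"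
    using assms by (auto intro!: transpI irreflpI dest: transpD)
  ultimately show False
    using irreflpD[OF irreflp_multp, of ?r M] by simp
qed

lemma path_less_irrefl:
  assumes p: "transp p" "irreflp p"
  shows "\<not> path_less p t t"
proof (induction "msize t" arbitrary: t rule: less_induct)
  case less
  obtain f n M where t: "t = Node f n M" by (cases t)
  have IH: "\<not> path_less p s s" if "s \<in># M" for s
    using less[of s] msize_arg[OF that, of f n] unfolding t by simp
  show ?case
  proof
    assume "path_less p t t"
    from path_less_Node_right[THEN iffD1, OF this[unfolded t]] irreflpD[OF p(2), of f]
    consider s where "s \<in># M" "(path_less p)\<^sup>=\<^sup>= t s" | "multp (path_less p) M M"
      by (auto simp: t)
    then show False
    proof cases
      case 1
      have "path_less p s t" unfolding t by (rule path_less.arg[OF 1(1)]) simp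
      then have "path_less p s s"
        using 1(2) path_less_trans[OF p(1), of s t s] by auto
      with IH[OF 1(1)] show False ..
    next
      case 2
      with not_multp_self[OF transp_path_less[OF p(1)] IH] show False by simp
    qed
  qed
qed

section \<open>Multisets of weakly decreasing arguments\<close>

lemma multp_union_right: "multp r A B \<Longrightarrow> multp r (A + C) (B + C)"
  unfolding multp_def mult_def
proof (induction rule: trancl_induct)
  case (base B)
  then show ?case using mult1_union[of A B _ C] by (auto simp: add.commute)
next
  case (step B D)
  then show ?case using mult1_union[of B D _ C] by (auto simp: add.commute intro: trancl_into_trancl)
qed

text \<open>The intermediate multiset is \<open>N + {#b#}\<close>. As \<open>K\<close> may be empty,
  the deletion of an argument is covered.\<close>

lemma multp_union_less:
  assumes "(multp r)\<^sup>=\<^sup>= N M" "\<And>x. x \<in># K \<Longrightarrow> r x b"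
  shows "multp r (N + K) (M + {#b#})"
proof -
  have *: "multp r (N + K) (N + {#b#})"
    by (rule one_step_implies_multp) (use assms(2) in auto)
  show ?thesis
    using assms(1) * multp_trans[OF *] multp_union_right[of r N M "{#b#}"] by auto
qed

lemma list_all2_imp_multp:
  "list_all2 r\<^sup>=\<^sup>= xs ys \<Longrightarrow> (multp r)\<^sup>=\<^sup>= (mset xs) (mset ys)"
proof (induction rule: list_all2_induct)
  case Nil
  then show ?case by simp
next
  case (Cons x xs y ys)
  show ?case
  proof (cases "x = y")
    case True
    then show ?thesis
      using Cons.IH multp_union_right[of r "mset xs" "mset ys" "{#y#}"] by auto
  next
    case False
    then have "multp r (mset xs + {#x#}) (mset ys + {#y#})"
      using Cons by (intro multp_union_less) auto
    then show ?thesis by simp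
  qed
qed

lemma list_all2_imp_dominated:
  assumes "list_all2 r\<^sup>=\<^sup>= xs ys" "x \<in> set xs"
  shows "\<exists>y \<in> set ys. r\<^sup>=\<^sup>= x y"
proof -
  obtain i where "i < length xs" "x = xs ! i"
    using assms(2) by (auto simp: in_set_conv_nth)
  then have "ys ! i \<in> set ys" "r\<^sup>=\<^sup>= x (ys ! i)"
    using assms(1) by (auto dest: list_all2_nthD list_all2_lengthD)
  then show ?thesis by blast
qed

lemma path_less_arg_list:
  assumes "list_all2 (path_less p)\<^sup>=\<^sup>= ts ss" "t \<in> set ts" "set ss \<subseteq> set_mset M"
  shows "path_less p t (Node f n M)"
proof -
  obtain s where "s \<in># M" "(path_less p)\<^sup>=\<^sup>= t s"
    using list_all2_imp_dominated[OF assms(1,2)] assms(3) by blast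
  then show ?thesis by (intro path_less.arg[of s]) auto
qed

text \<open>If the argument multisets agree, the labels decide; otherwise the arguments decrease
  strictly and \<open>mult\<close> applies whatever the labels are.\<close>

lemma path_less_Node_label:
  assumes "list_all2 (path_less p)\<^sup>=\<^sup>= ts ss" "m < n"
  shows "path_less p (Node f m (mset ts)) (Node f n (mset ss))"
proof (cases "mset ts = mset ss")
  case True
  then show ?thesis using path_less.label[OF assms(2)] by simp
next
  case False
  then show ?thesis
    using list_all2_imp_multp[OF assms(1)] path_less_arg_list[OF assms(1)]
    by (intro path_less.mult) auto
qed

lemma path_less_Node_le:
  assumes "list_all2 (path_less p)\<^sup>=\<^sup>= ts ss" "m \<le> n"
  shows "(path_less p)\<^sup>=\<^sup>= (Node f m (mset ts)) (Node f n (mset ss))"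
proof (cases "m = n \<and> mset ts = mset ss")
  case True
  then show ?thesis by simp
next
  case False
  show ?thesis
  proof (cases "mset ts = mset ss")
    case True
    then show ?thesis
      using False assms path_less_Node_label[OF assms(1)] by simp
  next
    case False
    then show ?thesis
      using list_all2_imp_multp[OF assms(1)] path_less_arg_list[OF assms(1)]
      by (intro sup2I1 path_less.mult) auto
  qed
qed

text \<open>One strict decrease among the arguments outweighs any change of label. A single
  \<open>c\<close> handles a context, a list of copies handles (down).\<close>

lemma path_less_Node_replace:
  assumes as: "list_all2 (path_less p)\<^sup>=\<^sup>= as' as"
    and bs: "list_all2 (path_less p)\<^sup>=\<^sup>= bs' bs"
    and cs: "\<And>c. c \<in> set cs \<Longrightarrow> path_less p c b"
  shows "path_less p (Node f m (mset (as' @ cs @ bs'))) (Node f n (mset (as @ b # bs)))"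
proof (rule path_less.mult)
  have "multp (path_less p) (mset (as' @ bs') + mset cs) (mset (as @ bs) + {#b#})"
    by (intro multp_union_less list_all2_imp_multp list_all2_appendI as bs) (use cs in auto)
  then show "multp (path_less p) (mset (as' @ cs @ bs')) (mset (as @ b # bs))"
    by (simp add: ac_simps)
  show "path_less p t (Node f n (mset (as @ b # bs)))" if "t \<in># mset (as' @ cs @ bs')" for t
  proof -
    consider "t \<in> set as'" | "t \<in> set cs" | "t \<in> set bs'" using \<open>t \<in># _\<close> by auto
    then show ?thesis
    proof cases
      case 1
      then show ?thesis by (rule path_less_arg_list[OF as]) auto
    next
      case 2
      then show ?thesis by (intro path_less.arg[of b]) (auto intro: cs)
    next
      case 3
      then show ?thesis by (rule path_less_arg_list[OF bs]) auto
    qed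
  qed
qed

section \<open>Decorated terms\<close>

fun symbol :: "'f starred \<Rightarrow> 'f" where
  "symbol (Plain f) = f"
| "symbol (Starred f) = f"

fun star_label :: "nat \<Rightarrow> 'f starred \<Rightarrow> enat" where
  "star_label k (Plain f) = \<infinity>"
| "star_label k (Starred f) = enat k"

text \<open>A symbol and its starred version share a head and differ only in the label. Variables
  become leaves with a constant label and a head that \<open>prec_on\<close> leaves
  incomparable.\<close>

fun decorate :: "nat \<Rightarrow> ('f starred, 'v) uterm \<Rightarrow> ('f + 'v) mtree" where
  "decorate k (Var x) = Node (Inr x) 0 {#}"
| "decorate k (Fun f ts) = Node (Inl (symbol f)) (star_label k f) (mset (map (decorate k) ts))"

lemma decorate_fill_cong:
  "decorate k s = decorate k t \<Longrightarrow> decorate k (fill C s) = decorate k (fill C t)"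
  by (induction C) auto

lemma decorate_tree_eq:
  assumes "(s, t) \<in> tree_eq \<Gamma> X"
  shows "decorate k s = decorate k t"
proof -
  have swap: "decorate k u = decorate k v" if "(u, v) \<in> rewrite \<Gamma> X (swap_rules \<Gamma> X)" for u v
    using that unfolding rewrite_def swap_rules_def by (auto intro!: decorate_fill_cong)
  have "(s, t) \<in> (rewrite \<Gamma> X (swap_rules \<Gamma> X) \<union> (rewrite \<Gamma> X (swap_rules \<Gamma> X))\<inverse>)\<^sup>*"
    using assms unfolding tree_eq_def by blast
  then show ?thesis
    by (induction rule: rtrancl_induct) (auto dest: swap)
qed

lemma decorate_star_free: "t \<in> terms (Plain ` \<Sigma>) X \<Longrightarrow> decorate k t = decorate l t"
  by (induction t) (auto simp: Var_in_terms Fun_in_terms intro!: image_mset_cong)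

text \<open>The smaller symbol comes first, reversing \<open>gt\<close>. Membership in \<Sigma> is
  built in, so that order properties assumed on \<Sigma> become global ones.\<close>

inductive prec_on :: "'f set \<Rightarrow> ('f \<Rightarrow> 'f \<Rightarrow> bool) \<Rightarrow> 'f + 'v \<Rightarrow> 'f + 'v \<Rightarrow> bool"
  for \<Sigma> gt where
  "f \<in> \<Sigma> \<Longrightarrow> g \<in> \<Sigma> \<Longrightarrow> gt f g \<Longrightarrow> prec_on \<Sigma> gt (Inl g) (Inl f)"

lemma transp_prec_on: "transp_on \<Sigma> gt \<Longrightarrow> transp (prec_on \<Sigma> gt)"
  by (intro transpI) (auto elim!: prec_on.cases intro!: prec_on.intros dest: transp_onD)

lemma irreflp_prec_on: "irreflp_on \<Sigma> gt \<Longrightarrow> irreflp (prec_on \<Sigma> gt)"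
  by (intro irreflpI) (auto elim!: prec_on.cases dest: irreflp_onD)

text \<open>A step also relabels the stars that it does not touch. The decrease is only weak because
  a star-free subterm keeps its decoration.\<close>

lemma decorate_Suc: "(path_less p)\<^sup>=\<^sup>= (decorate k t) (decorate (Suc k) t)"
proof (induction t)
  case (Var x)
  then show ?case by simp
next
  case (Fun f ts)
  then show ?case
    unfolding decorate.simps
    by (intro path_less_Node_le) (cases f; auto simp: list_all2_conv_all_nth)+
qed

lemma decorate_Suc_list:
  "list_all2 (path_less p)\<^sup>=\<^sup>= (map (decorate k) ts) (map (decorate (Suc k)) ts)"
  by (simp add: list_all2_conv_all_nth decorate_Suc del: sup_apply)

lemma decorate_fill:
  assumes st: "path_less p (decorate k t) (decorate (Suc k) s)"
  shows "path_less p (decorate k (fill C t)) (decorate (Suc k) (fill C s))"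
proof (induction C)
  case Hole
  then show ?case using st by simp
next
  case (More f ss C ts)
  show ?case
    \<comment> \<open>The siblings of the hole decrease weakly by relabelling, and the argument
      containing the hole decreases strictly.\<close>
    using path_less_Node_replace[OF decorate_Suc_list[of _ k ss] decorate_Suc_list[of _ k ts],
        of "[decorate k (fill C t)]"] More
    by simp
qed

lemma decorate_star_rules:
  assumes "(l, r) \<in> star_rules \<Sigma> X gt"
  shows "path_less (prec_on \<Sigma> gt) (decorate k (subst \<sigma> r)) (decorate (Suc k) (subst \<sigma> l))"
  using assms
proof cases
  case (put f xs)
  then show ?thesis
    using path_less_Node_label[OF decorate_Suc_list[of _ k "map \<sigma> xs"]]
    by (simp add: comp_def)
next
  case (select f xs y zs)
  then show ?thesis
    using decorate_Suc[of "prec_on \<Sigma> gt" k "\<sigma> y"]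
    by (auto intro!: path_less.arg[of "decorate (Suc k) (\<sigma> y)"])
next
  \<comment> \<open>The head drops in the precedence, and each starred copy lies below the original
    because its label is \<open>k\<close> instead of \<open>Suc k\<close>.\<close>
  case (copy f g xs n)
  then show ?thesis
    using path_less_Node_label[OF decorate_Suc_list[of _ k "map \<sigma> xs"], of "enat k" "enat (Suc k)"]
    by (auto simp: comp_def split: if_splits intro!: path_less.prec prec_on.intros)
next
  case (down f g xs ys zs n)
  \<comment> \<open>The new star lowers the label of \<open>g\<close> from \<infinity> to
    \<open>k\<close>; this decrease of an argument pays for the rise of the head label from
    \<open>Suc k\<close> to \<infinity>.\<close>
  have "path_less (prec_on \<Sigma> gt) (decorate k (Fun (Starred g) (map \<sigma> ys)))
      (decorate (Suc k) (Fun (Plain g) (map \<sigma> ys)))"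
    using path_less_Node_label[OF decorate_Suc_list[of _ k "map \<sigma> ys"]] by simp
  then have "path_less (prec_on \<Sigma> gt)
      (Node (Inl f) \<infinity> (mset (map (decorate k) (map \<sigma> xs) @
        replicate n (decorate k (Fun (Starred g) (map \<sigma> ys))) @ map (decorate k) (map \<sigma> zs))))
      (Node (Inl f) (enat (Suc k)) (mset (map (decorate (Suc k)) (map \<sigma> xs) @
        decorate (Suc k) (Fun (Plain g) (map \<sigma> ys)) # map (decorate (Suc k)) (map \<sigma> zs))))"
    by (intro path_less_Node_replace decorate_Suc_list) (simp del: decorate.simps)
  then show ?thesis using down by (simp add: comp_def)
qed

section \<open>Cycles of trees\<close>

lemma subst_in_terms:
  "t \<in> terms \<Gamma> X \<Longrightarrow> \<sigma> ` X \<subseteq> terms \<Gamma> X \<Longrightarrow> subst \<sigma> t \<in> terms \<Gamma> X"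
  by (induction t) (auto simp: Var_in_terms Fun_in_terms)

lemma star_rules_in_terms:
  "(l, r) \<in> star_rules \<Sigma> X gt \<Longrightarrow> l \<in> terms (star_sig \<Sigma>) X \<and> r \<in> terms (star_sig \<Sigma>) X"
  by (erule star_rules.cases) (auto simp: Var_in_terms Fun_in_terms star_sig_def subset_iff)

text \<open>Swaps leave decorations unchanged, so the decrease for one pair of representatives
  carries over to all. Nonemptiness supplies the intermediate representative when steps are
  chained.\<close>

lemma star_step_decreasing:
  assumes "(S, T) \<in> star_step \<Sigma> X gt"
  shows "T \<noteq> {}"
    and "s \<in> S \<Longrightarrow> t \<in> T \<Longrightarrow>
      path_less (prec_on \<Sigma> gt) (decorate k t) (decorate (Suc k) s)"
proof -
  let ?\<Gamma> = "star_sig \<Sigma>"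
  obtain C \<sigma> l r where C: "C \<in> ctxts ?\<Gamma> X" "\<sigma> ` X \<subseteq> terms ?\<Gamma> X"
    and lr: "(l, r) \<in> star_rules \<Sigma> X gt"
    and S: "S = tree_eq ?\<Gamma> X `` {fill C (subst \<sigma> l)}"
    and T: "T = tree_eq ?\<Gamma> X `` {fill C (subst \<sigma> r)}"
    using assms unfolding star_step_def tree_rewrite_def rewrite_def by blast
  have "fill C (subst \<sigma> r) \<in> terms ?\<Gamma> X"
    using C star_rules_in_terms[OF lr] by (simp add: fill_in_terms subst_in_terms)
  then show "T \<noteq> {}"
    unfolding T using equiv_class_self[OF equiv_tree_eq] by blast
  show "path_less (prec_on \<Sigma> gt) (decorate k t) (decorate (Suc k) s)" if "s \<in> S" "t \<in> T"
    using decorate_fill[OF decorate_star_rules[OF lr]] that unfolding S T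
    by (metis Image_singleton_iff decorate_tree_eq)
qed

lemma star_steps_decreasing:
  fixes X :: "'v set"
  assumes p: "transp (prec_on \<Sigma> gt :: 'f + 'v \<Rightarrow> _)"
  shows "(S, T) \<in> star_step \<Sigma> X gt ^^ Suc n \<Longrightarrow> s \<in> S \<Longrightarrow> t \<in> T \<Longrightarrow>
    path_less (prec_on \<Sigma> gt) (decorate k t) (decorate (k + Suc n) s)"
proof (induction n arbitrary: T t k)
  case 0
  then show ?case using star_step_decreasing(2) by simp
next
  case (Suc n)
  then obtain U where U: "(S, U) \<in> star_step \<Sigma> X gt ^^ Suc n" "(U, T) \<in> star_step \<Sigma> X gt"
    by (meson relpow_Suc_E)
  have "U \<noteq> {}"
    using U(1) star_step_decreasing(1) by (meson relpow_Suc_E)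
  then obtain u where u: "u \<in> U" by blast
  show ?case
    \<comment> \<open>The last step leads from label \<open>Suc k\<close> to \<open>k\<close>, so
      the earlier steps end at \<open>Suc k\<close> and start at
      \<open>Suc k + Suc n\<close>.\<close>
    using path_less_trans[OF p star_step_decreasing(2)[OF U(2) u Suc.prems(3), of k]
        Suc.IH[OF U(1) Suc.prems(2) u, of "Suc k"]] by simp
qed

theorem corollary4p19:
  fixes \<Sigma> :: "'f set" and X :: "'v set" and gt :: "'f \<Rightarrow> 'f \<Rightarrow> bool"
    and t :: "('f starred, 'v) uterm set"
  assumes "infinite X"
    and "irreflp_on \<Sigma> gt" and "transp_on \<Sigma> gt" and "wfp_on \<Sigma> gt\<inverse>\<inverse>"
    and "t \<in> trees (Plain ` \<Sigma>) X"
  shows "(t, t) \<notin> (star_step \<Sigma> X gt)\<^sup>+"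
proof
  assume "(t, t) \<in> (star_step \<Sigma> X gt)\<^sup>+"
  then obtain n where n: "(t, t) \<in> star_step \<Sigma> X gt ^^ Suc n"
    by (metis gr0_conv_Suc trancl_power)
  obtain s where s: "s \<in> t" "s \<in> terms (Plain ` \<Sigma>) X"
    using assms(5) equiv_class_self[OF equiv_tree_eq] unfolding trees_def by (auto elim!: quotientE)
  note p = transp_prec_on[OF assms(3), where 'b = 'v]
  \<comment> \<open>The same star-free \<open>s\<close> represents both ends of the cycle, so the
    two decorations compared here are equal.\<close>
  have "path_less (prec_on \<Sigma> gt) (decorate 0 s) (decorate (Suc n) s)"
    using star_steps_decreasing[OF p n s(1) s(1), of 0] by simp
  then show False
    using path_less_irrefl[OF p irreflp_prec_on[OF assms(2)]] decorate_star_free[OF s(2)] by metis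
qed

end
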